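(* Let $k \in \mathbb{N}^+$. Then $$B_{2k,k} = (k+3)\,2^{k-2} - 1.$$
   Context: For $n,k\in\mathbb{N}^+$, $B_{n,k}$ denotes the number of ways to split $n$ indistinguishable balls into any number of nonempty, ordered bins so that the most crowded bin contains exactly $k$ balls; equivalently, the number of compositions $(x_1,\dots,x_\ell)$ of $n$ (ordered tuples of positive integers of any length $\ell\ge 1$ summing to $n$) with $\max_i x_i = k$. *)

theory Defs
  imports Complex_Main
begin

definition compositions :: "nat \<Rightarrow> nat list set" where
  "compositions n = {xs. xs \<noteq> [] \<and> (\<forall>x\<in>set xs. x > 0) \<and> sum_list xs = n}"

definition B :: "nat \<Rightarrow> nat \<Rightarrow> nat" where
  "B n k = card {xs \<in> compositions n. Max (set xs) = k}"

text \<open>\<^const>\<open>card\<close> is 0 on infinite sets; the following shows that this convention never applies in \<^const>\<open>B\<close>.\<close>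

lemma finite_compositions: "finite (compositions n)"
proof (rule finite_subset)
  show "compositions n \<subseteq> {xs. set xs \<subseteq> {..n} \<and> length xs \<le> n}"
  proof
    fix xs assume "xs \<in> compositions n"
    then have pos: "\<forall>x\<in>set xs. x > 0" and s: "sum_list xs = n"
      by (auto simp: compositions_def)
    from pos have "length xs \<le> sum_list xs"
      by (induction xs) auto
    moreover have "set xs \<subseteq> {..n}"
      using s member_le_sum_list by fastforce
    ultimately show "xs \<in> {xs. set xs \<subseteq> {..n} \<and> length xs \<le> n}"
      using s by auto
  qed
qed (simp add: finite_lists_length_le)

end

(* A composition of 2k with largest part k has the form as @ k # bs with as and bs composing a total
   of k.  Taking the first occurrence of k makes the pair (as, bs) unique and excludes exactly the
   pair ([k], []).  The number of all pairs is a convolution of the numbers 1, 1, 2, 4, 8, ... of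
   possibly empty compositions. *)
theory Submission
  imports Defs
begin

definition compositions0 :: "nat \<Rightarrow> nat list set" where
  \<comment> \<open>Unlike \<^const>\<open>compositions\<close>, this contains the empty list when \<open>n = 0\<close>.\<close>
  "compositions0 n = {xs. 0 \<notin> set xs \<and> sum_list xs = n}"

lemma compositions0_0: "compositions0 0 = {[]}"
proof -
  have "xs = []" if "0 \<notin> set xs" "sum_list xs = 0" for xs :: "nat list"
    using that by (cases xs) auto
  then show ?thesis by (auto simp: compositions0_def)
qed

lemma compositions0_pos:
  assumes "n > 0"
  shows "compositions0 n = compositions n"
proof -
  have "(0 \<notin> set xs) = (\<forall>x\<in>set xs. x > 0)" for xs :: "nat list"
    by (metis gr0I less_irrefl)
  with assms show ?thesis by (auto simp: compositions0_def compositions_def)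
qed

lemma finite_compositions0: "finite (compositions0 n)"
  by (cases "n = 0") (simp_all add: compositions0_0 compositions0_pos finite_compositions)

text \<open>A leading 1 can be removed, and a leading part of at least 2 can be lowered by one. Both
  leave a total of \<open>Suc n\<close>, which is positive, so \<open>hd\<close> and
  \<open>tl\<close> are only applied to nonempty lists.\<close>

lemma compositions0_Suc_Suc:
  "compositions0 (Suc (Suc n)) =
     (#) 1 ` compositions0 (Suc n) \<union> (\<lambda>xs. Suc (hd xs) # tl xs) ` compositions0 (Suc n)"
  (is "?L = ?A \<union> ?B")
proof (intro equalityI subsetI)
  fix xs assume "xs \<in> ?L"
  then have xs: "0 \<notin> set xs" "sum_list xs = Suc (Suc n)" by (auto simp: compositions0_def)
  then obtain y ys where y: "xs = Suc y # ys"
    by (cases xs; cases "hd xs") auto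
  show "xs \<in> ?A \<union> ?B"
  proof (cases "y = 0")
    case True
    then show ?thesis using xs y by (auto simp: compositions0_def)
  next
    case False
    then have "y # ys \<in> compositions0 (Suc n)" "xs = Suc (hd (y # ys)) # tl (y # ys)"
      using xs y by (auto simp: compositions0_def)
    then show ?thesis by blast
  qed
next
  fix xs assume "xs \<in> ?A \<union> ?B"
  then show "xs \<in> ?L"
  proof
    assume "xs \<in> ?B"
    then obtain ys where ys: "ys \<in> compositions0 (Suc n)" "xs = Suc (hd ys) # tl ys" by blast
    then show ?thesis by (cases ys) (auto simp: compositions0_def)
  qed (auto simp: compositions0_def)
qed

lemma card_compositions0_Suc: "card (compositions0 (Suc n)) = 2 ^ n"
proof (induction n)
  case 0
  have "xs = [1]" if "0 \<notin> set xs" "sum_list xs = Suc 0" for xs :: "nat list"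
  proof -
    from that obtain y ys where xs: "xs = y # ys" by (cases xs) auto
    with that have ys: "y + sum_list ys = 1" "y > 0" "0 \<notin> set ys" by auto
    then have "y = 1" "sum_list ys = 0" by linarith+
    with ys have "ys \<in> compositions0 0" by (simp add: compositions0_def)
    with xs \<open>y = 1\<close> show ?thesis by (simp add: compositions0_0)
  qed
  then have "compositions0 (Suc 0) = {[1]}" by (auto simp: compositions0_def)
  then show ?case by simp
next
  case (Suc n)
  let ?W = "compositions0 (Suc n)" and ?g = "\<lambda>xs::nat list. Suc (hd xs) # tl xs"
  \<comment> \<open>Nonemptiness lets \<open>hd\<close> and \<open>tl\<close> determine the list, so
    \<open>?g\<close> is injective. The nonzero head makes \<open>?g xs\<close> start with at least
    2, which separates the two images.\<close>
  have ne: "xs \<noteq> []" "hd xs \<noteq> 0" if "xs \<in> ?W" for xs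
    using that by (cases xs; auto simp: compositions0_def)+
  have "inj_on ?g ?W"
  proof (rule inj_onI)
    fix xs ys assume "xs \<in> ?W" "ys \<in> ?W" "?g xs = ?g ys"
    then show "xs = ys" using ne(1)[of xs] ne(1)[of ys] by (intro list.expand) simp_all
  qed
  then have "card (?g ` ?W) = 2 ^ n" using Suc card_image by metis
  moreover have "card ((#) 1 ` ?W) = 2 ^ n" using Suc by (simp add: card_image)
  moreover have "(#) 1 ` ?W \<inter> ?g ` ?W = {}" using ne(2) by fastforce
  ultimately show ?case
    unfolding compositions0_Suc_Suc
    by (subst card_Un_disjoint) (auto simp: finite_compositions0)
qed

definition split_compositions :: "nat \<Rightarrow> (nat list \<times> nat list) set" where
  "split_compositions n =
     {(as, bs). 0 \<notin> set as \<and> 0 \<notin> set bs \<and> sum_list as + sum_list bs = n}"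

lemma split_compositions_iff:
  "(as, bs) \<in> split_compositions n \<longleftrightarrow>
     0 \<notin> set as \<and> 0 \<notin> set bs \<and> sum_list as + sum_list bs = n"
  by (simp add: split_compositions_def)

lemma split_compositions_eq:
  "split_compositions n = (\<Union>j\<in>{..n}. compositions0 j \<times> compositions0 (n - j))"
  by (auto simp: split_compositions_def compositions0_def)

lemma finite_split_compositions: "finite (split_compositions n)"
  by (simp add: split_compositions_eq finite_compositions0)

text \<open>In the convolution, the two end terms are \<open>2 ^ m\<close> each, and each of the m
  inner terms is half of that. Doubling avoids the exponent m - 1, which natural numbers would
  truncate at m = 0.\<close>

lemma card_split_compositions_Suc: "2 * card (split_compositions (Suc m)) = (m + 4) * 2 ^ m"
proof -
  let ?c = "\<lambda>j. card (compositions0 j)"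
  have "card (split_compositions (Suc m)) = (\<Sum>j\<le>Suc m. ?c j * ?c (Suc m - j))"
    unfolding split_compositions_eq
    by (subst card_UN_disjoint)
       (auto simp: finite_compositions0 card_cartesian_product, auto simp: compositions0_def)
  \<comment> \<open>The term j = 0 is split off and the index shifted to i = j - 1. The other end, i
    = m, is split off next, since \<open>?c 0 = 1\<close> does not follow the pattern of
    powers.\<close>
  also have "\<dots> = 2 ^ m + (\<Sum>i\<le>m. 2 ^ i * ?c (m - i))"
    by (subst sum.atMost_Suc_shift) (simp add: card_compositions0_Suc compositions0_0)
  also have "(\<Sum>i\<le>m. 2 ^ i * ?c (m - i)) = (\<Sum>i<m. 2 ^ i * ?c (m - i)) + 2 ^ m"
    by (simp add: compositions0_0 lessThan_Suc_atMost[symmetric])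
  finally have "2 * card (split_compositions (Suc m)) = 4 * 2 ^ m + (\<Sum>i<m. 2 * (2 ^ i * ?c (m - i)))"
    by (simp add: sum_distrib_left)
  also have "(\<Sum>i<m. 2 * (2 ^ i * ?c (m - i))) = (\<Sum>i<m. 2 ^ m)"
  proof (rule sum.cong)
    fix i assume "i \<in> {..<m}"
    then obtain d where "m = i + Suc d" by (auto simp: less_iff_Suc_add)
    then show "2 * (2 ^ i * ?c (m - i)) = 2 ^ m"
      by (simp add: card_compositions0_Suc power_add)
  qed simp
  finally show ?thesis by (simp add: algebra_simps)
qed

text \<open>An entry k already uses up the whole total, so all remaining entries sum to 0 and there
  are none.\<close>

lemma split_compositions_mem_fst:
  assumes "(as, bs) \<in> split_compositions k" "k \<in> set as"
  shows "as = [k]" "bs = []"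
proof -
  from assms(2) obtain us vs where as: "as = us @ k # vs" by (meson split_list)
  with assms have "us \<in> compositions0 0" "vs \<in> compositions0 0" "bs \<in> compositions0 0"
    by (auto simp: split_compositions_iff compositions0_def)
  with as show "as = [k]" "bs = []" by (auto simp: compositions0_0)
qed

lemma bij_betw_split_compositions:
  assumes "k > 0"
  shows "bij_betw (\<lambda>(as, bs). as @ k # bs) (split_compositions k - {([k], [])})
           {xs \<in> compositions (2 * k). Max (set xs) = k}"
    (is "bij_betw ?f ?P ?C")
proof -
  \<comment> \<open>Dropping the one pair is thus the same as requiring the displayed k to be the
    first one. Without this, \<open>([k], [])\<close> and \<open>([], [k])\<close> would both yield
    \<open>[k, k]\<close>.\<close>
  have P: "p \<in> ?P \<longleftrightarrow> p \<in> split_compositions k \<and> k \<notin> set (fst p)" for p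
    using split_compositions_mem_fst[of "fst p" "snd p" k] by (cases p) auto
  show ?thesis
  proof (rule bij_betw_imageI)
    \<comment> \<open>The entries before the first k recover \<open>as\<close> from the joined
      list.\<close>
    have "takeWhile (\<lambda>x. x \<noteq> k) (as @ k # bs) = as" if "k \<notin> set as" for as bs
      using that by (subst takeWhile_append2) auto
    then have "as = as'" if "as @ k # bs = as' @ k # bs'" "k \<notin> set as" "k \<notin> set as'" for as bs as' bs'
      using that by metis
    note fst_eq = this
    show "inj_on ?f ?P"
    proof (rule inj_onI)
      fix p q assume "p \<in> ?P" "q \<in> ?P" and eq: "?f p = ?f q"
      then have "fst p = fst q"
        unfolding P using fst_eq[of "fst p" "snd p" "fst q" "snd q"] by (simp add: case_prod_beta)
      with eq show "p = q" by (simp add: case_prod_beta prod_eq_iff)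
    qed
    show "?f ` ?P = ?C"
    proof (intro equalityI subsetI)
      fix xs assume "xs \<in> ?f ` ?P"
      then obtain as bs where *: "(as, bs) \<in> split_compositions k" "xs = as @ k # bs" by auto
      then have "xs \<in> compositions (2 * k)"
        using assms by (auto simp: split_compositions_iff compositions_def intro: gr0I)
      \<comment> \<open>Every entry of \<open>as\<close> or \<open>bs\<close> is bounded by their
        joint total k.\<close>
      moreover have "x \<le> k" if "x \<in> set xs" for x
        using that * member_le_sum_list[of x as] member_le_sum_list[of x bs]
        by (auto simp: split_compositions_iff)
      then have "Max (set xs) = k" using * by (intro Max_eqI) auto
      ultimately show "xs \<in> ?C" by simp
    next
      fix xs assume "xs \<in> ?C"
      then have xs: "xs \<noteq> []" "\<forall>x\<in>set xs. x > 0" "sum_list xs = 2 * k" "Max (set xs) = k"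
        by (auto simp: compositions_def)
      then have "k \<in> set xs" by (metis List.finite_set Max_in set_empty)
      then obtain as bs where *: "xs = as @ k # bs" "k \<notin> set as" by (meson split_list_first)
      with xs have "(as, bs) \<in> ?P" unfolding P by (auto simp: split_compositions_iff)
      with * show "xs \<in> ?f ` ?P" by force
    qed
  qed
qed

theorem mainTheorem2:
  fixes k :: nat
  assumes "k \<ge> 1"
  shows "real (B (2 * k) k) = (real k + 3) * 2 powi (int k - 2) - 1"
proof -
  from assms obtain m where m: "k = Suc m" by (cases k) auto
  have mem: "([k], []) \<in> split_compositions k" using assms by (simp add: split_compositions_iff)
  have "B (2 * k) k = card (split_compositions k - {([k], [])})"
    unfolding B_def using bij_betw_split_compositions[of k] assms by (simp add: bij_betw_same_card)
  \<comment> \<open>Adding the excluded pair back avoids subtraction on natural numbers.\<close>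
  also have "\<dots> + 1 = card (split_compositions k)"
    using card.remove[OF finite_split_compositions mem] by simp
  finally have "2 * (B (2 * k) k + 1) = (m + 4) * 2 ^ m"
    using card_split_compositions_Suc[of m] m by simp
  then have "real (2 * (B (2 * k) k + 1)) = real ((m + 4) * 2 ^ m)" by (rule arg_cong)
  then have "2 * (real (B (2 * k) k) + 1) = (real m + 4) * 2 ^ m" by simp
  \<comment> \<open>For k = 1 the exponent is -1, so halving is done in the reals.\<close>
  moreover have "(2::real) powi (int k - 2) = 2 ^ m / 2"
    using power_int_diff[of "2::real" "int m" 1] m by simp
  ultimately show ?thesis unfolding \<open>2 powi (int k - 2) = _\<close> using m by (simp add: algebra_simps)
qed

end
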